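(* Let $T$ be a densely defined closed operator from $H_1$ to $H_2$ which is absolutely minimum attaining. Then the range $R(T)$ is closed.
   Context: $H_1,H_2$ are infinite dimensional complex Hilbert spaces. For a densely defined closed operator $T$ with domain $D(T)\subseteq H_1$ and a closed subspace $M$ of $H_1$ with $D(T)\cap M\neq\{0\}$, put $m(T|_M)=\inf\{\|Tx\|: x\in D(T)\cap M,\ \|x\|=1\}$. $T$ is called absolutely minimum attaining if for every closed subspace $M$ of $H_1$ with $D(T)\cap M\ne\{0\}$ there is $x_0\in D(T)\cap M$ with $\|x_0\|=1$ and $\|Tx_0\|=m(T|_M)$. *)

theory Defs
  imports "HOL-Analysis.Analysis"
begin

text \<open>
  A complex inner product space also carries its underlying real inner product
  \<open>Re \<langle>x, y\<rangle>\<close>, so norm, metric and topology come from the class \<^class>\<open>real_inner\<close>.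
  The form is linear in its first argument. Positive definiteness is inherited from
  \<^class>\<open>real_inner\<close>; the lemmas below give it in terms of the complex form.
\<close>

class complex_inner = real_inner +
  fixes scaleC :: "complex \<Rightarrow> 'a \<Rightarrow> 'a"  (infixr \<open>*\<^sub>C\<close> 75)
    and cinner :: "'a \<Rightarrow> 'a \<Rightarrow> complex"
  assumes scaleC_add_right: "a *\<^sub>C (x + y) = a *\<^sub>C x + a *\<^sub>C y"
    and scaleC_add_left: "(a + b) *\<^sub>C x = a *\<^sub>C x + b *\<^sub>C x"
    and scaleC_scaleC: "a *\<^sub>C b *\<^sub>C x = (a * b) *\<^sub>C x"
    and scaleC_of_real: "complex_of_real r *\<^sub>C x = r *\<^sub>R x"
    and cinner_commute: "cinner x y = cnj (cinner y x)"
    and cinner_add_left: "cinner (x + y) z = cinner x z + cinner y z"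
    and cinner_scaleC_left: "cinner (a *\<^sub>C x) y = a * cinner x y"
    and Re_cinner: "Re (cinner x y) = inner x y"

class complex_hilbert_space = complex_inner + complete_space

lemma cinner_self: "cinner x x = complex_of_real ((norm x)\<^sup>2)"
  for x :: "'a::complex_inner"
proof (rule complex_eqI)
  show "Im (cinner x x) = Im (complex_of_real ((norm x)\<^sup>2))"
    using arg_cong[OF cinner_commute[of x x], of Im] by simp
qed (simp add: Re_cinner power2_norm_eq_inner)

lemma cinner_self_eq_0_iff: "cinner x x = 0 \<longleftrightarrow> x = 0"
  for x :: "'a::complex_inner"
  by (simp add: cinner_self)

lemma norm_eq_sqrt_cinner: "norm x = sqrt (Re (cinner x x))"
  for x :: "'a::complex_inner"
  by (simp add: cinner_self)

global_interpretation complex_vector: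
  vector_space "scaleC :: complex \<Rightarrow> 'a \<Rightarrow> 'a::complex_inner"
proof
  fix x :: 'a
  show "1 *\<^sub>C x = x"
    using scaleC_of_real[of 1 x] by simp
qed (simp_all add: scaleC_add_right scaleC_add_left scaleC_scaleC)

definition infinite_dimensional :: "'a::complex_inner itself \<Rightarrow> bool" where
  "infinite_dimensional _ \<longleftrightarrow>
     \<not> (\<exists>B :: 'a set. finite B \<and> complex_vector.span B = UNIV)"

text \<open>
  A partially defined operator is given by its domain \<open>D\<close> and a function \<open>T\<close> whose values
  outside \<open>D\<close> are irrelevant; its range is \<open>T ` D\<close>.
\<close>

definition linear_operator ::
    "'a::complex_inner set \<Rightarrow> ('a \<Rightarrow> 'b::complex_inner) \<Rightarrow> bool" where
  "linear_operator D T \<longleftrightarrow>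
     complex_vector.subspace D \<and>
     (\<forall>x\<in>D. \<forall>y\<in>D. T (x + y) = T x + T y) \<and>
     (\<forall>c. \<forall>x\<in>D. T (c *\<^sub>C x) = c *\<^sub>C T x)"

definition densely_defined :: "'a::complex_inner set \<Rightarrow> bool" where
  "densely_defined D \<longleftrightarrow> closure D = UNIV"

definition closed_operator ::
    "'a::complex_inner set \<Rightarrow> ('a \<Rightarrow> 'b::complex_inner) \<Rightarrow> bool" where
  "closed_operator D T \<longleftrightarrow> linear_operator D T \<and> closed {(x, T x) | x. x \<in> D}"

text \<open>
  The set is nonempty whenever \<open>D \<inter> M \<noteq> {0}\<close> for subspaces \<open>D\<close> and \<open>M\<close>, and it is bounded
  below by 0; only then is the real infimum meaningful.
\<close>

definition min_modulus_on ::
    "'a::complex_inner set \<Rightarrow> ('a \<Rightarrow> 'b::complex_inner) \<Rightarrow> 'a set \<Rightarrow> real" where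
  "min_modulus_on D T M = Inf {norm (T x) | x. x \<in> D \<inter> M \<and> norm x = 1}"

definition absolutely_minimum_attaining ::
    "'a::complex_inner set \<Rightarrow> ('a \<Rightarrow> 'b::complex_inner) \<Rightarrow> bool" where
  "absolutely_minimum_attaining D T \<longleftrightarrow>
     (\<forall>M. complex_vector.subspace M \<and> closed M \<and> D \<inter> M \<noteq> {0} \<longrightarrow>
        (\<exists>x\<^sub>0 \<in> D \<inter> M. norm x\<^sub>0 = 1 \<and> norm (T x\<^sub>0) = min_modulus_on D T M))"

end

theory Submission
  imports Defs
begin

text \<open>
  Let \<open>N\<close> be the kernel of \<open>T\<close>, a closed subspace, and \<open>M = N\<^sup>\<bottom>\<close>. The minimum of \<open>\<parallel>T x\<parallel>\<close> over unit
  vectors \<open>x \<in> D \<inter> M\<close> is attained, hence positive, because \<open>T\<close> is injective on \<open>D \<inter> M\<close>. So \<open>T\<close> is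
  bounded below on \<open>D \<inter> M\<close>. Since \<open>N \<subseteq> D\<close>, orthogonal projection shows that the image of \<open>D \<inter> M\<close>
  is the whole range, and a closed operator that is bounded below has closed range.
\<close>

text \<open>Balls need not be compact, so completeness does the work: the near-minimizers within
  \<open>d + e n\<close> form decreasing closed sets whose diameters tend to 0 by the parallelogram
  law, and Cantor's intersection theorem gives a common point.\<close>

lemma closest_point_in_closed_convex:
  fixes S :: "'a::{real_inner, complete_space} set"
  assumes "closed S" "convex S" "S \<noteq> {}"
  obtains y where "y \<in> S" "\<And>z. z \<in> S \<Longrightarrow> dist x y \<le> dist x z"
proof -
  define d where "d = infdist x S"
  define e :: "nat \<Rightarrow> real" where "e n = inverse (real (Suc n))" for n
  define C where "C n = S \<inter> cball x (d + e n)" for n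
  have d: "d \<le> dist x z" if "z \<in> S" for z
    unfolding d_def using that by (rule infdist_le)
  have e_pos: "e n > 0" for n
    by (simp add: e_def)
  have e_lim: "e \<longlonglongrightarrow> 0"
    unfolding e_def by (rule LIMSEQ_inverse_real_of_nat)
  have d0: "d \<ge> 0"
    by (simp add: d_def infdist_nonneg)
  \<comment> \<open>The midpoint stays in \<open>S\<close> by convexity, hence at distance at least
    \<open>d\<close> from \<open>x\<close>. The parallelogram law then bounds the square by
    \<open>4 * (d + e n)^2 - 4 * d^2\<close>, which is the right-hand side.\<close>
  have diam: "(dist u v)\<^sup>2 \<le> 8 * d * e n + 4 * (e n)\<^sup>2" if "u \<in> C n" "v \<in> C n" for u v n
  proof -
    have "midpoint u v \<in> S"
      using that \<open>convex S\<close> convexD[of S u v "1/2" "1/2"]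
      by (simp add: C_def midpoint_def scaleR_right_distrib)
    then have mid: "d\<^sup>2 \<le> (dist x (midpoint u v))\<^sup>2"
      using d d0 power_mono by blast
    have near: "(dist x u)\<^sup>2 \<le> (d + e n)\<^sup>2" "(dist x v)\<^sup>2 \<le> (d + e n)\<^sup>2"
      using that by (auto simp: C_def intro!: power_mono)
    have "(dist u v)\<^sup>2 + 4 * (dist x (midpoint u v))\<^sup>2 = 2 * (dist x u)\<^sup>2 + 2 * (dist x v)\<^sup>2"
      unfolding dist_norm midpoint_def power2_norm_eq_inner
      by (simp add: inner_commute algebra_simps)
    then show ?thesis
      using mid near by (simp add: power2_eq_square algebra_simps)
  qed
  obtain y where "\<And>n. y \<in> C n"
  proof (rule decreasing_closed_nest[of C])
    show "closed (C n)" for n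
      using \<open>closed S\<close> by (simp add: C_def closed_Int)
    show "C n \<noteq> {}" for n
    proof -
      have "infdist x S < d + e n"
        using e_pos[of n] by (simp add: d_def)
      then obtain z where "z \<in> S" "dist x z < d + e n"
        using \<open>S \<noteq> {}\<close> cINF_less_iff[of S "dist x" "d + e n"]
        by (auto simp: infdist_notempty)
      then show ?thesis
        by (auto simp: C_def)
    qed
    show "C n \<subseteq> C m" if "m \<le> n" for m n
    proof -
      have "e n \<le> e m"
        using that by (simp add: e_def le_imp_inverse_le)
      then show ?thesis
        by (auto simp: C_def)
    qed
    show "\<exists>n. \<forall>u\<in>C n. \<forall>v\<in>C n. dist u v < r" if "r > 0" for r
    proof -
      have "(\<lambda>n. 8 * d * e n + 4 * (e n)\<^sup>2) \<longlonglongrightarrow> 8 * d * 0 + 4 * 0\<^sup>2"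
        by (intro tendsto_intros e_lim)
      then have "eventually (\<lambda>n. 8 * d * e n + 4 * (e n)\<^sup>2 < r\<^sup>2) sequentially"
        using \<open>r > 0\<close> by (intro order_tendstoD(2)) auto
      then obtain n where "8 * d * e n + 4 * (e n)\<^sup>2 < r\<^sup>2"
        by (auto simp: eventually_sequentially)
      then have "dist u v < r" if "u \<in> C n" "v \<in> C n" for u v
        using diam[OF that] \<open>r > 0\<close> by (intro power2_less_imp_less[of _ r]) auto
      then show ?thesis
        by blast
    qed
  qed blast
  then have y: "y \<in> S" "dist x y \<le> d + e n" for n
    by (auto simp: C_def)
  have "dist x y \<le> d + 0"
    by (rule LIMSEQ_le_const[OF tendsto_add[OF tendsto_const e_lim]]) (use y in auto)
  then show thesis
    using that[of y] y(1) d by force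
qed

lemma orthogonal_decomposition_exists:
  fixes N :: "'a::{real_inner, complete_space} set"
  assumes "subspace N" "closed N"
  obtains y where "y \<in> N" "x - y \<in> N\<^sup>\<bottom>"
proof -
  obtain y where y: "y \<in> N" "\<And>z. z \<in> N \<Longrightarrow> dist x y \<le> dist x z"
    using closest_point_in_closed_convex[of N x] assms subspace_imp_convex subspace_0 by blast
  \<comment> \<open>This is the variational inequality for the closest point, tested at
    \<open>y + n\<close>. As \<open>N\<close> also contains \<open>- n\<close>, it becomes an
    equality below.\<close>
  have le: "inner (x - y) n \<le> 0" if "n \<in> N" for n
    using any_closest_point_dot[of N y "y + n" x] assms y that
    by (simp add: subspace_imp_convex subspace_add)
  have "inner (x - y) n = 0" if "n \<in> N" for n
    using le[OF that] le[of "- n"] that assms by (simp add: subspace_neg)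
  then have "x - y \<in> N\<^sup>\<bottom>"
    by (simp add: orthogonal_comp_def orthogonal_def inner_commute)
  then show thesis
    using that y(1) by blast
qed

lemma complex_subspace_imp_subspace:
  "complex_vector.subspace S \<Longrightarrow> subspace S"
  unfolding complex_vector.subspace_def subspace_def by (metis scaleC_of_real)

text \<open>Real part of the corresponding identity for \<open>cinner\<close>. It links complex
  scalars to orthogonality, which is taken with respect to the real form.\<close>

lemma inner_scaleC_left:
  "inner (c *\<^sub>C x) y = inner x (cnj c *\<^sub>C y)"
proof -
  have "cinner x (cnj c *\<^sub>C y) = cnj (cinner (cnj c *\<^sub>C y) x)"
    by (rule cinner_commute)
  also have "\<dots> = c * cnj (cinner y x)"
    by (simp add: cinner_scaleC_left)
  also have "\<dots> = cinner (c *\<^sub>C x) y"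
    by (simp add: cinner_scaleC_left flip: cinner_commute)
  finally show ?thesis
    by (metis Re_cinner)
qed

text \<open>
  Here \<open>N\<^sup>\<bottom>\<close> is the complement for the real inner product; for a complex subspace it
  agrees with the one for the complex form.
\<close>

lemma complex_subspace_orthogonal_comp:
  assumes "complex_vector.subspace N"
  shows "complex_vector.subspace (N\<^sup>\<bottom>)"
proof (rule complex_vector.subspaceI)
  show "c *\<^sub>C x \<in> N\<^sup>\<bottom>" if x: "x \<in> N\<^sup>\<bottom>" for c x
  proof -
    have "inner n (c *\<^sub>C x) = 0" if "n \<in> N" for n
    proof -
      \<comment> \<open>Moved to the other argument, the scalar acts on \<open>n\<close>, and
        \<open>N\<close> is stable under complex scalars.\<close>
      have "inner (cnj c *\<^sub>C n) x = 0"
        using x complex_vector.subspace_scale[OF assms that]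
        by (simp add: orthogonal_comp_def orthogonal_def)
      then show ?thesis
        by (simp add: inner_scaleC_left)
    qed
    then show ?thesis
      by (simp add: orthogonal_comp_def orthogonal_def)
  qed
qed (simp_all add: orthogonal_comp_def orthogonal_def inner_add_right)

lemma closed_orthogonal_comp: "closed (W\<^sup>\<bottom>)"
proof -
  have "W\<^sup>\<bottom> = (\<Inter>w\<in>W. {x. inner w x = 0})"
    by (auto simp: orthogonal_comp_def orthogonal_def)
  also have "closed \<dots>"
    by (intro closed_INT ballI closed_Collect_eq continuous_intros)
  finally show ?thesis .
qed

context
  fixes D :: "'a::complex_inner set" and T :: "'a \<Rightarrow> 'b::complex_inner"
  assumes lin: "linear_operator D T"
begin

lemma domain_subspace: "complex_vector.subspace D"
  using lin by (simp add: linear_operator_def)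

lemma linear_operator_scaleR: "x \<in> D \<Longrightarrow> T (r *\<^sub>R x) = r *\<^sub>R T x"
  using lin by (simp add: linear_operator_def flip: scaleC_of_real)

lemma linear_operator_diff:
  assumes "x \<in> D" "y \<in> D"
  shows "T (x - y) = T x - T y"
proof -
  have "x - y \<in> D"
    using assms domain_subspace complex_vector.subspace_diff by blast
  then have "T ((x - y) + y) = T (x - y) + T y"
    using lin assms by (simp only: linear_operator_def)
  then show ?thesis by simp
qed

lemma linear_operator_zero: "T 0 = 0"
  using linear_operator_scaleR[of 0 0] complex_vector.subspace_0[OF domain_subspace] by simp

lemma kernel_subspace: "complex_vector.subspace {x \<in> D. T x = 0}"
  using lin linear_operator_zero
  by (auto simp: linear_operator_def complex_vector.subspace_def)

end

text \<open>\<open>T\<close> may be discontinuous, so the closed graph is used instead: the kernel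
  is its preimage under the continuous map sending \<open>x\<close> to
  \<open>(x, 0)\<close>.\<close>

lemma kernel_closed:
  assumes "closed_operator D T"
  shows "closed {x \<in> D. T x = 0}"
proof -
  have "{x \<in> D. T x = 0} = (\<lambda>x. (x, 0)) -` {(x, T x) | x. x \<in> D}"
    by auto
  also have "closed \<dots>"
    using assms unfolding closed_operator_def
    by (intro closed_vimage continuous_intros) auto
  finally show ?thesis .
qed

text \<open>The lower bound makes preimages in \<open>E\<close> of a convergent sequence of values
  Cauchy. Differences of such preimages must stay in \<open>E\<close> for the bound to apply, hence
  the subspace assumption.\<close>

lemma closed_range_if_bounded_below:
  fixes D :: "'a::complex_hilbert_space set" and T :: "'a \<Rightarrow> 'b::complex_inner"
  assumes op: "closed_operator D T" and E: "subspace E" "E \<subseteq> D" "T ` D \<subseteq> T ` E"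
    and c: "c > 0" "\<And>x. x \<in> E \<Longrightarrow> c * norm x \<le> norm (T x)"
  shows "closed (T ` D)"
  unfolding closed_sequential_limits
proof (intro allI impI, elim conjE)
  fix f y assume f: "\<forall>n. f n \<in> T ` D" "f \<longlonglongrightarrow> y"
  have lin: "linear_operator D T" and graph: "closed {(x, T x) | x. x \<in> D}"
    using op by (auto simp: closed_operator_def)
  have "\<forall>n. \<exists>x\<in>E. f n = T x"
    using f(1) E(3) by blast
  then obtain g where g: "\<And>n. g n \<in> E" "\<And>n. f n = T (g n)"
    by metis
  have "Cauchy g"
  proof (rule metric_CauchyI)
    fix r :: real assume "r > 0"
    then obtain K where K: "\<And>m n. m \<ge> K \<Longrightarrow> n \<ge> K \<Longrightarrow> dist (f m) (f n) < c * r"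
      using metric_CauchyD[OF LIMSEQ_imp_Cauchy[OF f(2)], of "c * r"] c(1) by auto
    have "dist (g m) (g n) < r" if "m \<ge> K" "n \<ge> K" for m n
    proof -
      have "c * norm (g m - g n) \<le> norm (T (g m - g n))"
        using g(1) E(1) by (intro c(2) subspace_diff)
      also have "\<dots> = dist (f m) (f n)"
        using g E(2) by (simp add: linear_operator_diff[OF lin] subset_iff dist_norm)
      also have "\<dots> < c * r"
        using K that by blast
      finally show ?thesis
        using c(1) by (simp add: dist_norm)
    qed
    then show "\<exists>K. \<forall>m\<ge>K. \<forall>n\<ge>K. dist (g m) (g n) < r"
      by blast
  qed
  then obtain x where x: "g \<longlonglongrightarrow> x"
    using Cauchy_convergent convergentD by blast
  \<comment> \<open>The limit \<open>x\<close> may leave \<open>E\<close>; the closed graph still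
    yields \<open>x\<close> in \<open>D\<close> with \<open>T x = y\<close>.\<close>
  have "(\<lambda>n. (g n, f n)) \<longlonglongrightarrow> (x, y)"
    by (intro tendsto_Pair x f(2))
  then have "(x, y) \<in> {(x, T x) | x. x \<in> D}"
    by (rule closed_sequentially[OF graph, rotated]) (use g E(2) in auto)
  then show "y \<in> T ` D"
    by auto
qed

theorem proposition4p2:
  fixes D :: "'a::complex_hilbert_space set"
    and T :: "'a \<Rightarrow> 'b::complex_hilbert_space"
  assumes "infinite_dimensional TYPE('a)"
    and "infinite_dimensional TYPE('b)"
    and "densely_defined D"
    and "closed_operator D T"
    and "absolutely_minimum_attaining D T"
  shows "closed (T ` D)"
proof -
  have lin: "linear_operator D T"
    using assms(4) by (simp add: closed_operator_def)
  note D = complex_subspace_imp_subspace[OF domain_subspace[OF lin]]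
  define N where "N = {x \<in> D. T x = 0}"
  define M where "M = N\<^sup>\<bottom>"
  have N: "complex_vector.subspace N" "closed N"
    unfolding N_def by (rule kernel_subspace[OF lin], rule kernel_closed[OF assms(4)])
  have M: "complex_vector.subspace M" "closed M"
    unfolding M_def
    by (rule complex_subspace_orthogonal_comp[OF N(1)], rule closed_orthogonal_comp)
  have DM: "subspace (D \<inter> M)"
    using D complex_subspace_imp_subspace[OF M(1)] by (rule subspace_inter)
  have range: "T ` D \<subseteq> T ` (D \<inter> M)"
  proof
    fix z assume "z \<in> T ` D"
    then obtain x where x: "x \<in> D" "z = T x" by blast
    obtain y where "y \<in> N" "x - y \<in> M"
      using orthogonal_decomposition_exists[OF complex_subspace_imp_subspace[OF N(1)] N(2)]
      unfolding M_def by blast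
    \<comment> \<open>Subtracting \<open>y\<close> keeps the vector in \<open>D\<close> and does not
      change its image, since \<open>y\<close> is in the kernel.\<close>
    then have "x - y \<in> D \<inter> M" "T (x - y) = z"
      using x D by (auto simp: N_def subspace_diff linear_operator_diff[OF lin])
    then show "z \<in> T ` (D \<inter> M)" by blast
  qed
  have "\<exists>c>0. \<forall>x\<in>D \<inter> M. c * norm x \<le> norm (T x)"
  \<comment> \<open>Attainment is assumed only for nontrivial \<open>D \<inter> M\<close>. The
    trivial case does occur, for instance when \<open>T\<close> vanishes on \<open>D\<close>, and
    there any positive constant serves.\<close>
  proof (cases "D \<inter> M = {0}")
    case True
    then have "\<forall>x\<in>D \<inter> M. 1 * norm x \<le> norm (T x)"
      by simp
    then show ?thesis
      using zero_less_one by blast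
  next
    case False
    then obtain x0 where x0: "x0 \<in> D \<inter> M" "norm x0 = 1" "norm (T x0) = min_modulus_on D T M"
      using assms(5) M unfolding absolutely_minimum_attaining_def by blast
    have "norm (T x0) > 0"
    proof (rule ccontr)
      assume "\<not> norm (T x0) > 0"
      \<comment> \<open>Otherwise \<open>x0\<close> lies in both \<open>N\<close> and its orthogonal
        complement, so it is orthogonal to itself.\<close>
      then have "inner x0 x0 = 0"
        using x0(1) by (auto simp: N_def M_def orthogonal_comp_def orthogonal_def)
      then show False
        using x0(2) by simp
    qed
    moreover have "norm (T x0) * norm x \<le> norm (T x)" if "x \<in> D \<inter> M" for x
    proof (cases "x = 0")
      case False
      define u where "u = x /\<^sub>R norm x"
      have u: "u \<in> D \<inter> M" "norm u = 1"
        using that False subspace_scale[OF DM] by (auto simp: u_def)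
      \<comment> \<open>The attained minimum bounds the value at the unit vector \<open>u\<close>;
        homogeneity then carries the bound over to \<open>x\<close>. The lower bound 0 makes the
        real infimum meaningful.\<close>
      have "norm (T x0) \<le> norm (T u)"
        unfolding x0(3) min_modulus_on_def
        by (rule cInf_lower) (use u in \<open>auto intro!: bdd_belowI[of _ 0]\<close>)
      also have "\<dots> = norm (T x) / norm x"
        using that by (simp add: u_def linear_operator_scaleR[OF lin] divide_inverse)
      finally show ?thesis
        using False by (simp add: field_simps)
    qed simp
    ultimately show ?thesis
      by blast
  qed
  then show ?thesis
    using closed_range_if_bounded_below[OF assms(4) DM _ range] by blast
qed

end
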